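(* For every $p\in[1,\infty]\setminus\{1,2,\infty\}$, there is no local Y-$\Delta$ transform (i.e. local $3$-star-mesh transform) that preserves the $d_p$ metric.
   Context: For a graph $G=(V,E,w)$ with positive edge weights and $p\in[1,\infty)$, $d_{p,G}(s,t)=\min\{(\sum_{e\in E}|f(e)/w(e)|^p)^{1/p}: f \text{ a flow shipping one unit from } s \text{ to } t\}$ (with $\max_e|f(e)/w(e)|$ instead for $p=\infty$). A $k$-star-mesh transform is an operation that, given a graph $G$ and a vertex $r\in V(G)$ of degree $k$, removes $r$ from $G$ and replaces the $k$-star formed by $r$ and its neighbors with a (possibly weighted) clique on the neighbor set $N(r)$; the case $k=3$ is called the Y-$\Delta$ transform. Such a transform is local if the edge weights inside the clique on $N(r)$ in the transformed graph depend only on the weights of the $k$ star edges of $r$ in $G$ (obliviously to the rest of $G$). A local $k$-star-mesh transform preserves $d_p$ if for every graph $G=(V,E,w)$ and every vertex $r\in V$ of degree $k$, applying the transform to $G$ and $r$ yields a graph $G'$ with $d_{p,G'}(s,t)=d_{p,G}(s,t)$ for all $s,t\in V\setminus\{r\}$. *)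

theory Defs
  imports "HOL-Library.Extended_Real" "HOL-Library.Infinite_Typeclass"
begin

(* Finite undirected graphs with positive edge weights. Edges are abstract and carry their
   two-element set of endpoints, so parallel edges are possible: replacing a star by a clique
   creates them whenever two neighbours of the removed vertex are already adjacent. *)

record ('v, 'e) wgraph =
  verts :: "'v set"
  edges :: "'e set"
  ends :: "'e \<Rightarrow> 'v set"
  weight :: "'e \<Rightarrow> real"

definition weighted_multigraph :: "('v, 'e) wgraph \<Rightarrow> bool" where
  "weighted_multigraph G \<longleftrightarrow>
     finite (verts G) \<and> finite (edges G) \<and>
     (\<forall>e\<in>edges G. ends G e \<subseteq> verts G \<and> card (ends G e) = 2 \<and> weight G e > 0)"

(* In a simple graph an edge is its set of endpoints. *)

definition weighted_graph :: "('v, 'v set) wgraph \<Rightarrow> bool" where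
  "weighted_graph G \<longleftrightarrow> weighted_multigraph G \<and> (\<forall>e\<in>edges G. ends G e = e)"

definition star :: "('v, 'e) wgraph \<Rightarrow> 'v \<Rightarrow> 'e set" where
  "star G r = {e \<in> edges G. r \<in> ends G e}"

definition degree :: "('v, 'e) wgraph \<Rightarrow> 'v \<Rightarrow> nat" where
  "degree G r = card (star G r)"

definition neighbours :: "('v, 'e) wgraph \<Rightarrow> 'v \<Rightarrow> 'v set" where
  "neighbours G r = (\<Union>e\<in>star G r. ends G e) - {r}"

(* A flow is a signed function on the edges. The linear order on the vertices only serves to fix
   a reference orientation, from the smaller to the larger endpoint: a positive value is flow in
   that direction, a negative value flow against it. Reorienting an edge changes the sign of the
   flow on it, hence neither the cost of a flow nor the distance below. *)

definition net_outflow :: "('v::linorder, 'e) wgraph \<Rightarrow> ('e \<Rightarrow> real) \<Rightarrow> 'v \<Rightarrow> real" where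
  "net_outflow G f v =
     (\<Sum>e | e \<in> edges G \<and> Min (ends G e) = v. f e) - (\<Sum>e | e \<in> edges G \<and> Max (ends G e) = v. f e)"

definition unit_flow :: "('v::linorder, 'e) wgraph \<Rightarrow> 'v \<Rightarrow> 'v \<Rightarrow> ('e \<Rightarrow> real) \<Rightarrow> bool" where
  "unit_flow G s t f \<longleftrightarrow>
     (\<forall>v\<in>verts G. net_outflow G f v = (if v = s then 1 else 0) - (if v = t then 1 else 0))"

(* The element 0 only matters for the maximum if there are no edges. *)

definition flow_cost :: "ereal \<Rightarrow> ('v, 'e) wgraph \<Rightarrow> ('e \<Rightarrow> real) \<Rightarrow> real" where
  "flow_cost p G f =
     (if p = \<infinity> then Max (insert 0 ((\<lambda>e. \<bar>f e / weight G e\<bar>) ` edges G))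
      else (\<Sum>e\<in>edges G. \<bar>f e / weight G e\<bar> powr real_of_ereal p) powr (1 / real_of_ereal p))"

(* If s and t are connected, the infimum is a minimum (a norm is minimised over a nonempty affine
   subspace of a finite-dimensional space); otherwise there is no unit flow and the value is
   \<infinity>. *)

definition flow_dist :: "ereal \<Rightarrow> ('v::linorder, 'e) wgraph \<Rightarrow> 'v \<Rightarrow> 'v \<Rightarrow> ereal" where
  "flow_dist p G s t = (INF f\<in>{f. unit_flow G s t f}. ereal (flow_cost p G f))"

definition clique :: "'v set \<Rightarrow> 'v set set" where
  "clique N = {X. X \<subseteq> N \<and> card X = 2}"

(* A transform maps a graph and a vertex to the transformed graph. The edges of the latter are
   Inl e for the surviving edges e, and Inr X for the new clique edges X. *)

type_synonym 'v transform = "('v, 'v set) wgraph \<Rightarrow> 'v \<Rightarrow> ('v, 'v set + 'v set) wgraph"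

definition star_mesh_transform :: "nat \<Rightarrow> 'v transform \<Rightarrow> bool" where
  "star_mesh_transform k T \<longleftrightarrow>
     (\<forall>G r. weighted_graph G \<and> r \<in> verts G \<and> degree G r = k \<longrightarrow>
        weighted_multigraph (T G r) \<and>
        verts (T G r) = verts G - {r} \<and>
        edges (T G r) = Inl ` (edges G - star G r) \<union> Inr ` clique (neighbours G r) \<and>
        (\<forall>e \<in> edges G - star G r.
           ends (T G r) (Inl e) = ends G e \<and> weight (T G r) (Inl e) = weight G e) \<and>
        (\<forall>X \<in> clique (neighbours G r). ends (T G r) (Inr X) = X))"

(* Only graphs with the same labelled star at r are compared, so the clique weights may depend on
   which star edge carries which weight. *)

definition local_transform :: "nat \<Rightarrow> 'v transform \<Rightarrow> bool" where
  "local_transform k T \<longleftrightarrow>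
     (\<forall>G H r. weighted_graph G \<and> r \<in> verts G \<and> degree G r = k \<and>
        weighted_graph H \<and> r \<in> verts H \<and> degree H r = k \<and>
        star G r = star H r \<and> (\<forall>e \<in> star G r. weight G e = weight H e) \<longrightarrow>
        (\<forall>X \<in> clique (neighbours G r). weight (T G r) (Inr X) = weight (T H r) (Inr X)))"

definition preserves_flow_dist :: "ereal \<Rightarrow> nat \<Rightarrow> 'v::linorder transform \<Rightarrow> bool" where
  "preserves_flow_dist p k T \<longleftrightarrow>
     (\<forall>G r. weighted_graph G \<and> r \<in> verts G \<and> degree G r = k \<longrightarrow>
        (\<forall>s \<in> verts G - {r}. \<forall>t \<in> verts G - {r}.
           flow_dist p (T G r) s t = flow_dist p G s t))"

end

theory Submission
  imports Defs "HOL-Analysis.Convex"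
begin

text \<open>
  Attach an edge of resistance \<open>\<rho>\<close> between the leaves \<open>b, c\<close> of a unit star with leaves
  \<open>a, b, c\<close>; by locality the triangle replacing the star has resistances \<open>x, y, z\<close> that do not
  depend on \<open>\<rho>\<close>. Here an edge of weight \<open>w\<close> has resistance \<open>w powr (- q)\<close>, so that the
  \<open>q\<close>-th power of the distance is a minimal energy, and this energy is a concave function of
  \<open>\<rho>\<close> having the \<open>q\<close>-th power of the optimal flow through the extra edge as a supergradient. Hence
  the star and the triangle send the same flow through that edge, which for \<open>s = 1 / (q - 1)\<close>
  says that
  \<open>1 + (1 + \<rho>) powr s = (1 + ((z + \<sigma>) / x) powr s) * (1 + (\<rho> / y) powr s)\<close>,
  where \<open>\<sigma>\<close> is the resistance of \<open>y\<close> and \<open>\<rho>\<close> in parallel.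
  If \<open>s < 1\<close>, then as \<open>\<rho> \<rightarrow> 0\<close> the left-hand side is \<open>2 + O(\<rho>)\<close> while the right-hand side
  exceeds \<open>2\<close> by a multiple of \<open>\<rho> powr s\<close>. If \<open>s > 1\<close>, then as \<open>\<rho> \<rightarrow> \<infinity>\<close> the left-hand side
  exceeds \<open>\<rho> powr s\<close> by an unbounded amount, the right-hand side by a bounded one.
\<close>

section \<open>Parallel resistances for energies of degree \<open>q\<close>\<close>

text \<open>Young's inequality with exponents \<open>q\<close> and \<open>q / (q - 1)\<close>. As a
  function of \<open>k\<close> the left-hand side is the tangent at
  \<open>k = \<kappa> * \<tau>\<close> of the energy on the right; its slope does not involve
  \<open>\<kappa>\<close>.\<close>

lemma powr_tangent_le:
  fixes q \<kappa> k \<tau> :: real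
  assumes "q > 1" "\<kappa> > 0" "k \<ge> 0" "\<tau> \<ge> 0"
  shows "q * k * \<tau> powr (q - 1) - (q - 1) * \<kappa> * \<tau> powr q \<le> \<kappa> powr (1 - q) * k powr q"
proof -
  have "k / \<kappa> * \<tau> powr (q - 1)
      \<le> (k / \<kappa>) powr q / q + (\<tau> powr (q - 1)) powr (q / (q - 1)) / (q / (q - 1))"
    using assms by (intro Youngs_inequality) (auto simp: field_simps)
  also have "(\<tau> powr (q - 1)) powr (q / (q - 1)) = \<tau> powr q"
    using assms by (simp add: powr_powr)
  finally have *: "k / \<kappa> * \<tau> powr (q - 1) \<le> (k / \<kappa>) powr q / q + \<tau> powr q / (q / (q - 1))" .
  have "q * \<kappa> * (k / \<kappa> * \<tau> powr (q - 1)) \<le> q * \<kappa> * ((k / \<kappa>) powr q / q + \<tau> powr q / (q / (q - 1)))"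
    using assms by (intro mult_left_mono[OF *]) auto
  also have "\<dots> = \<kappa> * (k / \<kappa>) powr q + (q - 1) * \<kappa> * \<tau> powr q"
    using assms by (simp add: field_simps)
  also have "\<kappa> * (k / \<kappa>) powr q = \<kappa> powr (1 - q) * k powr q"
    using assms by (simp add: powr_divide powr_diff)
  finally show ?thesis using assms by simp
qed

text \<open>Solves \<open>u = \<kappa> powr (1 - q)\<close> for \<open>\<kappa>\<close>. With this
  normalisation the conductances of parallel edges add, and the optimal flow splits in proportion to
  them.\<close>

definition conductance :: "real \<Rightarrow> real \<Rightarrow> real" where
  "conductance q u = u powr (- 1 / (q - 1))"

definition parallel :: "real \<Rightarrow> real \<Rightarrow> real \<Rightarrow> real" where
  "parallel q u v = (conductance q u + conductance q v) powr (1 - q)"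

definition share :: "real \<Rightarrow> real \<Rightarrow> real \<Rightarrow> real" where
  "share q u v = conductance q u / (conductance q u + conductance q v)"

lemma conductance_pos: "u > 0 \<Longrightarrow> conductance q u > 0"
  by (simp add: conductance_def)

lemma resistance_eq:
  assumes "q > 1" "u > 0" shows "conductance q u powr (1 - q) = u"
proof -
  have "(- 1 / (q - 1)) * (1 - q) = 1"
    using assms by (simp add: field_simps)
  then have "conductance q u powr (1 - q) = u powr 1"
    unfolding conductance_def powr_powr by (rule arg_cong)
  then show ?thesis using assms by simp
qed

lemma parallel_pos: "u > 0 \<Longrightarrow> v > 0 \<Longrightarrow> parallel q u v > 0"
  using conductance_pos[of u q] conductance_pos[of v q] by (simp add: parallel_def)

lemma share_bounds:
  assumes "u > 0" "v > 0" shows "share q u v > 0" "share q u v < 1"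
  using conductance_pos[of u q] conductance_pos[of v q] assms by (auto simp: share_def)

lemma one_minus_share:
  assumes "u > 0" "v > 0" shows "1 - share q u v = share q v u"
  using conductance_pos[of u q] conductance_pos[of v q] assms by (auto simp: share_def field_simps)

text \<open>The tangents for the two edges at the same \<open>\<tau>\<close> have equal slopes, so
  their sum depends only on the total flow. With \<open>parallel_eq\<close> this makes
  \<open>parallel\<close> the least energy of a unit flow over two parallel edges and
  \<open>share\<close> its optimal split.\<close>

lemma parallel_le:
  fixes q u v k m :: real
  assumes "q > 1" "u > 0" "v > 0"
  shows "parallel q u v * \<bar>k + m\<bar> powr q \<le> u * \<bar>k\<bar> powr q + v * \<bar>m\<bar> powr q"
proof -
  define \<kappa> \<mu> where "\<kappa> = conductance q u" and "\<mu> = conductance q v"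
  have pos: "\<kappa> > 0" "\<mu> > 0"
    using assms by (auto simp: \<kappa>_def \<mu>_def conductance_pos)
  \<comment> \<open>Flow per unit of conductance, common to both edges in the optimal split.\<close>
  define \<tau> where "\<tau> = (\<bar>k\<bar> + \<bar>m\<bar>) / (\<kappa> + \<mu>)"
  have \<tau>: "\<tau> \<ge> 0" "\<bar>k\<bar> + \<bar>m\<bar> = (\<kappa> + \<mu>) * \<tau>"
    using pos by (auto simp: \<tau>_def)
  have "parallel q u v * \<bar>k + m\<bar> powr q \<le> (\<kappa> + \<mu>) powr (1 - q) * (\<bar>k\<bar> + \<bar>m\<bar>) powr q"
    unfolding parallel_def \<kappa>_def \<mu>_def using assms by (intro mult_left_mono powr_mono2) auto
  also have "\<dots> = (\<kappa> + \<mu>) * \<tau> powr q"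
    unfolding \<tau>(2) using pos \<tau>(1) by (simp add: powr_mult powr_diff)
  also have "\<dots> = q * ((\<kappa> + \<mu>) * \<tau>) * \<tau> powr (q - 1) - (q - 1) * (\<kappa> + \<mu>) * \<tau> powr q"
    using \<tau>(1) assms(1) by (cases "\<tau> = 0") (auto simp: powr_diff algebra_simps)
  also have "\<dots> = (q * \<bar>k\<bar> * \<tau> powr (q - 1) - (q - 1) * \<kappa> * \<tau> powr q)
                + (q * \<bar>m\<bar> * \<tau> powr (q - 1) - (q - 1) * \<mu> * \<tau> powr q)"
    unfolding \<tau>(2)[symmetric] by (simp add: algebra_simps)
  also have "\<dots> \<le> \<kappa> powr (1 - q) * \<bar>k\<bar> powr q + \<mu> powr (1 - q) * \<bar>m\<bar> powr q"
    using assms pos \<tau> by (intro add_mono powr_tangent_le) auto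
  also have "\<dots> = u * \<bar>k\<bar> powr q + v * \<bar>m\<bar> powr q"
    using assms by (simp add: \<kappa>_def \<mu>_def resistance_eq)
  finally show ?thesis .
qed

lemma parallel_eq:
  fixes q u v :: real
  assumes "q > 1" "u > 0" "v > 0"
  shows "u * share q u v powr q + v * share q v u powr q = parallel q u v"
proof -
  define \<kappa> \<mu> where "\<kappa> = conductance q u" and "\<mu> = conductance q v"
  have pos: "\<kappa> > 0" "\<mu> > 0"
    using assms by (auto simp: \<kappa>_def \<mu>_def conductance_pos)
  have uv: "u = \<kappa> powr (1 - q)" "v = \<mu> powr (1 - q)"
    using assms resistance_eq by (auto simp: \<kappa>_def \<mu>_def)
  have "u * share q u v powr q + v * share q v u powr q
      = \<kappa> powr (1 - q) * (\<kappa> / (\<kappa> + \<mu>)) powr q + \<mu> powr (1 - q) * (\<mu> / (\<kappa> + \<mu>)) powr q"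
    unfolding share_def \<kappa>_def[symmetric] \<mu>_def[symmetric]
    by (simp add: uv[symmetric] add.commute)
  also have "\<dots> = (\<kappa> + \<mu>) powr (1 - q)"
    using pos by (simp add: powr_divide powr_diff add_divide_distrib)
  finally show ?thesis by (simp add: parallel_def \<kappa>_def \<mu>_def)
qed

lemma inverse_share:
  assumes "q > 1" "u > 0" "v > 0"
  shows "1 / share q u v = 1 + (u / v) powr (1 / (q - 1))"
  using assms by (simp add: share_def conductance_def powr_minus powr_divide field_simps)

lemma parallel_less:
  assumes "q > 1" "u > 0" "v > 0"
  shows "parallel q u v < u" "parallel q u v < v"
proof -
  have *: "parallel q u v < conductance q w powr (1 - q)" if "w = u \<or> w = v" for w
    unfolding parallel_def using that assms conductance_pos[of u q] conductance_pos[of v q]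
    by (intro powr_less_mono2_neg) auto
  then show "parallel q u v < u" "parallel q u v < v"
    using *[of u] *[of v] assms by (simp_all add: resistance_eq)
qed

section \<open>Minimal energies of the star and the triangle with an extra edge\<close>

text \<open>A unit flow from \<open>a\<close> to \<open>b\<close> in the unit star: the first
  summand is the forced flow out of \<open>a\<close>; \<open>g\<close> units make the detour from
  the centre through \<open>c\<close> and the extra edge, in series of total resistance
  \<open>1 + \<rho>\<close>.\<close>

definition star_energy :: "real \<Rightarrow> real \<Rightarrow> real \<Rightarrow> real" where
  "star_energy q \<rho> g = 1 + \<bar>1 - g\<bar> powr q + (1 + \<rho>) * \<bar>g\<bar> powr q"

text \<open>Here \<open>x\<close>, \<open>y\<close>, \<open>z\<close> belong to the edges
  \<open>ab\<close>, \<open>bc\<close>, \<open>ac\<close>. Of the unit sent from \<open>a\<close> to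
  \<open>b\<close>, \<open>h\<close> goes via \<open>c\<close>, where \<open>k\<close> takes the
  extra edge and \<open>h - k\<close> the clique edge parallel to it.\<close>

definition triangle_energy :: "real \<Rightarrow> real \<Rightarrow> real \<Rightarrow> real \<Rightarrow> real \<Rightarrow> real \<Rightarrow> real \<Rightarrow> real" where
  "triangle_energy q x y z \<rho> h k =
     x * \<bar>1 - h\<bar> powr q + z * \<bar>h\<bar> powr q + y * \<bar>h - k\<bar> powr q + \<rho> * \<bar>k\<bar> powr q"

definition star_flow :: "real \<Rightarrow> real \<Rightarrow> real" where
  "star_flow q \<rho> = share q (1 + \<rho>) 1"

definition triangle_flow :: "real \<Rightarrow> real \<Rightarrow> real \<Rightarrow> real \<Rightarrow> real \<Rightarrow> real" where
  "triangle_flow q x y z \<rho> = share q (z + parallel q y \<rho>) x"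

lemma star_energy_min:
  assumes "q > 1" "\<rho> > 0"
  shows "star_energy q \<rho> (star_flow q \<rho>) \<le> star_energy q \<rho> g"
proof -
  have "star_energy q \<rho> (star_flow q \<rho>) = 1 + parallel q (1 + \<rho>) 1"
    using parallel_eq[of q "1 + \<rho>" 1] share_bounds[of "1 + \<rho>" 1 q] one_minus_share[of "1 + \<rho>" 1 q] assms
    by (simp add: star_energy_def star_flow_def)
  also have "\<dots> \<le> star_energy q \<rho> g"
    using parallel_le[of q "1 + \<rho>" 1 g "1 - g"] assms by (simp add: star_energy_def)
  finally show ?thesis .
qed

text \<open>Series-parallel reduction: for fixed \<open>h\<close> the parallel pair
  \<open>y\<close>, \<open>\<rho>\<close> acts as one resistance \<open>\<sigma>\<close>; then
  \<open>z\<close> and \<open>\<sigma>\<close> in series are parallel to \<open>x\<close>.\<close>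

lemma triangle_energy_min:
  fixes x y z \<rho> :: real
  assumes "q > 1" "x > 0" "y > 0" "z > 0" "\<rho> > 0"
  defines "h0 \<equiv> triangle_flow q x y z \<rho>"
  shows "triangle_energy q x y z \<rho> h0 (h0 * share q \<rho> y) \<le> triangle_energy q x y z \<rho> h k"
proof -
  define \<sigma> where "\<sigma> = parallel q y \<rho>"
  have \<sigma>: "\<sigma> > 0" using assms by (simp add: \<sigma>_def parallel_pos)
  have h0: "h0 = share q (z + \<sigma>) x" "1 - h0 = share q x (z + \<sigma>)" "h0 > 0" "h0 < 1"
    using assms \<sigma> by (auto simp: h0_def triangle_flow_def \<sigma>_def one_minus_share share_bounds)
  have k0: "h0 - h0 * share q \<rho> y = h0 * share q y \<rho>"
    using one_minus_share[of \<rho> y q] assms by (metis mult.right_neutral right_diff_distrib)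
  have "y * \<bar>h0 - h0 * share q \<rho> y\<bar> powr q + \<rho> * \<bar>h0 * share q \<rho> y\<bar> powr q
      = h0 powr q * (y * share q y \<rho> powr q + \<rho> * share q \<rho> y powr q)"
    unfolding k0 using h0 assms share_bounds[of y \<rho> q] share_bounds[of \<rho> y q]
    by (simp add: abs_mult powr_mult algebra_simps)
  also have "\<dots> = h0 powr q * \<sigma>"
    using assms by (simp add: parallel_eq \<sigma>_def)
  finally have "triangle_energy q x y z \<rho> h0 (h0 * share q \<rho> y)
      = (z + \<sigma>) * h0 powr q + x * (1 - h0) powr q"
    using h0 by (simp add: triangle_energy_def algebra_simps)
  also have "\<dots> = parallel q (z + \<sigma>) x"
    unfolding h0(1,2) using one_minus_share[of "z + \<sigma>" x q] assms \<sigma> by (simp add: parallel_eq)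
  also have "\<dots> \<le> (z + \<sigma>) * \<bar>h\<bar> powr q + x * \<bar>1 - h\<bar> powr q"
    using parallel_le[of q "z + \<sigma>" x h "1 - h"] assms \<sigma> by simp
  also have "\<sigma> * \<bar>h\<bar> powr q \<le> y * \<bar>h - k\<bar> powr q + \<rho> * \<bar>k\<bar> powr q"
    using parallel_le[of q y \<rho> "h - k" k] assms by (simp add: \<sigma>_def)
  then have "(z + \<sigma>) * \<bar>h\<bar> powr q + x * \<bar>1 - h\<bar> powr q \<le> triangle_energy q x y z \<rho> h k"
    by (simp add: triangle_energy_def algebra_simps)
  finally show ?thesis .
qed

section \<open>Uniqueness of supergradients and equality of the optimal flows\<close>

text \<open>Adding the inequality for \<open>g\<close> at \<open>r\<close> to the one for
  \<open>f\<close> at \<open>r'\<close> gives \<open>f r' \<le> g r\<close> to the right of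
  \<open>r\<close> and \<open>g r \<le> f r'\<close> to the left. Continuity of \<open>f\<close> at
  \<open>r\<close> closes the gap.\<close>

lemma supergradient_unique:
  fixes L f g :: "real \<Rightarrow> real"
  assumes f: "\<And>\<rho> \<rho>'. \<rho> > 0 \<Longrightarrow> \<rho>' > 0 \<Longrightarrow> L \<rho>' \<le> L \<rho> + (\<rho>' - \<rho>) * f \<rho>"
    and g: "\<And>\<rho> \<rho>'. \<rho> > 0 \<Longrightarrow> \<rho>' > 0 \<Longrightarrow> L \<rho>' \<le> L \<rho> + (\<rho>' - \<rho>) * g \<rho>"
    and cont: "isCont f r" and r: "r > 0"
  shows "f r = g r"
proof (rule antisym)
  have "f r' \<le> g r" if "r' > r" for r'
  proof -
    have "0 \<le> (r' - r) * (g r - f r')"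
      using g[of r r'] f[of r' r] that r by (simp add: algebra_simps)
    then show ?thesis using that by (simp add: zero_le_mult_iff)
  qed
  then have "eventually (\<lambda>r'. f r' \<le> g r) (at_right r)"
    by (auto simp: eventually_at_right_less eventually_at intro!: exI[of _ 1])
  moreover have "(f \<longlongrightarrow> f r) (at_right r)"
    using cont by (simp add: isCont_def filterlim_at_split)
  ultimately show "f r \<le> g r"
    by (intro tendsto_upperbound) auto
next
  have "g r \<le> f r'" if "r' < r" "r' > 0" for r'
  proof -
    have "0 \<le> (r - r') * (f r' - g r)"
      using f[of r' r] g[of r r'] that r by (simp add: algebra_simps)
    then show ?thesis using that by (simp add: zero_le_mult_iff)
  qed
  then have "eventually (\<lambda>r'. g r \<le> f r') (at_left r)"
    using r by (auto simp: eventually_at dist_real_def intro!: exI[of _ r])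
  moreover have "(f \<longlongrightarrow> f r) (at_left r)"
    using cont by (simp add: isCont_def filterlim_at_split)
  ultimately show "g r \<le> f r"
    by (intro tendsto_lowerbound) auto
qed

text \<open>A flow that is optimal for \<open>\<rho>\<close> stays admissible for
  \<open>\<rho>'\<close>, where its energy changes by \<open>\<rho>' - \<rho>\<close> times the
  \<open>q\<close>-th power of the flow through the extra edge. Both networks thus give
  supergradients of the same function.\<close>

lemma flows_agree:
  fixes x y z \<rho> :: real
  assumes q: "q > 1" and pos: "x > 0" "y > 0" "z > 0" "\<rho> > 0"
    and eq: "\<And>\<rho>. \<rho> > 0 \<Longrightarrow> star_energy q \<rho> (star_flow q \<rho>) =
      triangle_energy q x y z \<rho> (triangle_flow q x y z \<rho>) (triangle_flow q x y z \<rho> * share q \<rho> y)"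
  shows "star_flow q \<rho> = triangle_flow q x y z \<rho> * share q \<rho> y"
proof -
  define F where "F \<rho> = triangle_flow q x y z \<rho> * share q \<rho> y" for \<rho>
  have "star_flow q \<rho> powr q = \<bar>F \<rho>\<bar> powr q"
  proof (rule supergradient_unique[where L = "\<lambda>\<rho>. star_energy q \<rho> (star_flow q \<rho>)"
        and f = "\<lambda>\<rho>. star_flow q \<rho> powr q" and g = "\<lambda>\<rho>. \<bar>F \<rho>\<bar> powr q"])
    fix \<rho> \<rho>' :: real assume "\<rho> > 0" "\<rho>' > 0"
    then show "star_energy q \<rho>' (star_flow q \<rho>')
        \<le> star_energy q \<rho> (star_flow q \<rho>) + (\<rho>' - \<rho>) * star_flow q \<rho> powr q"
      using star_energy_min[OF q, of \<rho>' "star_flow q \<rho>"] share_bounds[of "1 + \<rho>" 1 q]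
      by (simp add: star_energy_def star_flow_def algebra_simps)
    show "star_energy q \<rho>' (star_flow q \<rho>')
        \<le> star_energy q \<rho> (star_flow q \<rho>) + (\<rho>' - \<rho>) * \<bar>F \<rho>\<bar> powr q"
      using triangle_energy_min[OF q pos(1-3), of \<rho>' "triangle_flow q x y z \<rho>" "F \<rho>"] \<open>\<rho> > 0\<close> \<open>\<rho>' > 0\<close>
      unfolding eq[OF \<open>\<rho> > 0\<close>] eq[OF \<open>\<rho>' > 0\<close>]
      by (simp add: triangle_energy_def F_def algebra_simps)
  next
    show "isCont (\<lambda>\<rho>. star_flow q \<rho> powr q) \<rho>"
    proof -
      have "1 + \<rho> > 0" using pos by simp
      then have "conductance q (1 + \<rho>) + conductance q 1 \<noteq> 0" "star_flow q \<rho> \<noteq> 0"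
        using conductance_pos[of "1 + \<rho>" q] conductance_pos[of 1 q] share_bounds[of "1 + \<rho>" 1 q]
        by (auto simp: star_flow_def)
      then show ?thesis
        using \<open>1 + \<rho> > 0\<close> unfolding star_flow_def share_def conductance_def
        by (intro continuous_intros) auto
    qed
  qed fact
  \<comment> \<open>Both flows are positive, so their \<open>q\<close>-th powers determine
    them.\<close>
  moreover have "star_flow q \<rho> > 0" "F \<rho> > 0"
    using pos by (auto simp: star_flow_def F_def triangle_flow_def share_bounds parallel_pos add_pos_pos)
  ultimately have "(star_flow q \<rho> powr q) powr (1 / q) = (F \<rho> powr q) powr (1 / q)"
    by simp
  then show ?thesis
    using q \<open>star_flow q \<rho> > 0\<close> \<open>F \<rho> > 0\<close> by (simp add: powr_powr F_def)
qed

section \<open>Contradiction from small and large resistances\<close>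

lemma parallel_tendsto:
  assumes "q > 1" "y > 0"
  shows "((\<lambda>\<rho>. parallel q y \<rho>) \<longlongrightarrow> y) at_top"
proof -
  have "((\<lambda>\<rho>. conductance q \<rho>) \<longlongrightarrow> 0) at_top"
    unfolding conductance_def using assms by (intro tendsto_neg_powr filterlim_ident) auto
  then have "((\<lambda>\<rho>. parallel q y \<rho>) \<longlongrightarrow> (conductance q y + 0) powr (1 - q)) at_top"
    unfolding parallel_def using conductance_pos[of y q] assms by (intro tendsto_intros) auto
  then show ?thesis using assms resistance_eq by simp
qed

lemma flow_identity_absurd:
  fixes s x y z :: real and \<sigma> :: "real \<Rightarrow> real"
  assumes s: "s > 0" "s \<noteq> 1" and pos: "x > 0" "y > 0" "z > 0"
    and \<sigma>: "\<And>\<rho>. \<rho> > 0 \<Longrightarrow> \<sigma> \<rho> > 0" "\<And>\<rho>. \<rho> > 0 \<Longrightarrow> \<sigma> \<rho> < \<rho>" "\<And>\<rho>. \<rho> > 0 \<Longrightarrow> \<sigma> \<rho> < y"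
    and lim: "(\<sigma> \<longlongrightarrow> y) at_top"
    and eq: "\<And>\<rho>. \<rho> > 0 \<Longrightarrow>
      1 + (1 + \<rho>) powr s = (1 + ((z + \<sigma> \<rho>) / x) powr s) * (1 + (\<rho> / y) powr s)"
  shows False
proof (cases "s < 1")
  case True
  \<comment> \<open>Replacing \<open>\<sigma> \<rho>\<close> by its upper bound
    \<open>\<rho>\<close> gives an expression whose limit at 0 is explicit, namely
    \<open>1 + (z / x) powr s\<close>.\<close>
  have "2 \<le> (1 + ((z + \<rho>) / x) powr s) * (1 + (\<rho> / y) powr s)" if "\<rho> > 0" for \<rho>
  proof -
    have "2 \<le> 1 + (1 + \<rho>) powr s" using that s by (simp add: ge_one_powr_ge_zero)
    also have "\<dots> \<le> (1 + ((z + \<rho>) / x) powr s) * (1 + (\<rho> / y) powr s)"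
      unfolding eq[OF that] using that \<sigma>(1,2)[OF that] pos s
      by (intro mult_right_mono add_left_mono powr_mono2 divide_right_mono) auto
    finally show ?thesis .
  qed
  moreover have "((\<lambda>\<rho>. (1 + ((z + \<rho>) / x) powr s) * (1 + (\<rho> / y) powr s)) \<longlongrightarrow>
      (1 + ((z + 0) / x) powr s) * (1 + (0 / y) powr s)) (at_right 0)"
    using pos s by (intro tendsto_intros tendsto_powr')
      (auto simp: eventually_at_right_less eventually_at intro!: exI[of _ 1])
  ultimately have "2 \<le> (1 + ((z + 0) / x) powr s) * (1 + (0 / y) powr s)"
    by (intro tendsto_lowerbound) (auto simp: eventually_at intro!: exI[of _ 1])
  then have A: "2 \<le> 1 + (z / x) powr s" by simp
  \<comment> \<open>Chosen so that \<open>(\<rho> / y) powr s = \<rho>\<close>, whereas the identity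
    at this point forces \<open>2 * (\<rho> / y) powr s \<le> \<rho>\<close>.\<close>
  define \<rho> where "\<rho> = (1 / y powr s) powr (1 / (1 - s))"
  have \<rho>: "\<rho> > 0" "\<rho> powr (1 - s) = 1 / y powr s"
    using pos True by (auto simp: \<rho>_def powr_powr)
  have "2 * (1 + (\<rho> / y) powr s) \<le> (1 + ((z + \<sigma> \<rho>) / x) powr s) * (1 + (\<rho> / y) powr s)"
    using pos s \<rho>(1) \<sigma>(1)[OF \<rho>(1)]
    by (intro mult_right_mono order_trans[OF A] add_left_mono powr_mono2 divide_right_mono) auto
  also have "\<dots> = 1 + (1 + \<rho>) powr s" using eq[OF \<rho>(1)] by simp
  also have "(1 + \<rho>) powr s \<le> (1 + \<rho>) powr 1"
    using True \<rho>(1) by (intro powr_mono) auto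
  finally have "2 * (\<rho> / y) powr s \<le> \<rho>" using \<rho>(1) by simp
  moreover have "(\<rho> / y) powr s = \<rho>"
  proof -
    have "(\<rho> / y) powr s = \<rho> powr s * \<rho> powr (1 - s)"
      unfolding \<rho>(2) using \<rho>(1) pos by (simp add: powr_divide)
    then show ?thesis using \<rho>(1) by (simp flip: powr_add)
  qed
  ultimately show False using \<rho>(1) by simp
next
  case False
  then have s1: "s > 1" using s by simp
  \<comment> \<open>The limit of the first factor on the right, since \<open>\<sigma>\<close> tends
    to \<open>y\<close>, and also an upper bound for it.\<close>
  define B where "B = 1 + ((z + y) / x) powr s"
  have B: "B > 1" using pos by (simp add: B_def)
  have R: "((\<lambda>\<rho>. (1 + ((z + \<sigma> \<rho>) / x) powr s) * (\<rho> powr (-s) + 1 / y powr s)) \<longlongrightarrow>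
      (1 + ((z + y) / x) powr s) * (0 + 1 / y powr s)) at_top"
    using pos s by (intro tendsto_intros lim tendsto_neg_powr filterlim_ident) auto
  have L: "((\<lambda>\<rho>. \<rho> powr (-s) + (1 + 1 / \<rho>) powr s) \<longlongrightarrow> 0 + (1 + 0) powr s) at_top"
    using s by (intro tendsto_intros tendsto_neg_powr filterlim_ident tendsto_divide_0 [OF tendsto_const]
      filterlim_at_top_imp_at_infinity) auto
  \<comment> \<open>The identity divided by \<open>\<rho> powr s\<close>, which makes both sides
    converge.\<close>
  have LR: "eventually (\<lambda>\<rho>. \<rho> powr (-s) + (1 + 1 / \<rho>) powr s =
      (1 + ((z + \<sigma> \<rho>) / x) powr s) * (\<rho> powr (-s) + 1 / y powr s)) at_top"
    using eventually_gt_at_top[of 0]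
  proof eventually_elim
    case (elim \<rho>)
    have "\<rho> powr (-s) + (1 + 1 / \<rho>) powr s = \<rho> powr (-s) * (1 + (1 + \<rho>) powr s)"
      using elim by (simp add: powr_minus powr_divide field_simps flip: powr_mult)
    also have "\<dots> = (1 + ((z + \<sigma> \<rho>) / x) powr s) * (\<rho> powr (-s) * (1 + (\<rho> / y) powr s))"
      using eq[OF elim] by simp
    also have "\<rho> powr (-s) * (1 + (\<rho> / y) powr s) = \<rho> powr (-s) + 1 / y powr s"
      using elim pos by (simp add: powr_minus powr_divide field_simps)
    finally show ?case .
  qed
  have "0 + (1 + 0) powr s = (1 + ((z + y) / x) powr s) * (0 + 1 / y powr s)"
    using tendsto_unique[OF trivial_limit_at_top_linorder L[unfolded tendsto_cong[OF LR]] R] .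
  then have By: "B = y powr s" using pos by (simp add: B_def field_simps)
  \<comment> \<open>With \<open>\<rho> powr (s - 1) = B\<close> the left-hand side of the identity
    is at least \<open>1 + \<rho> powr s + B\<close>, while \<open>B = y powr s\<close> bounds the
    right-hand side by \<open>B + \<rho> powr s\<close>.\<close>
  define \<rho> where "\<rho> = B powr (1 / (s - 1))"
  have \<rho>: "\<rho> > 0" "\<rho> powr (s - 1) = B"
    using B s1 by (auto simp: \<rho>_def powr_powr)
  have "\<rho> powr s + B = (1 + \<rho>) * \<rho> powr (s - 1)"
    unfolding \<rho>(2)[symmetric] using \<rho>(1) by (simp add: powr_diff field_simps)
  also have "\<dots> \<le> (1 + \<rho>) * (1 + \<rho>) powr (s - 1)"
    using \<rho>(1) s1 by (intro mult_left_mono powr_mono2) auto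
  also have "\<dots> = (1 + \<rho>) powr s"
    using \<rho>(1) by (simp add: powr_diff)
  finally have "1 + \<rho> powr s + B \<le> (1 + ((z + \<sigma> \<rho>) / x) powr s) * (1 + (\<rho> / y) powr s)"
    using eq[OF \<rho>(1)] by simp
  also have "\<dots> \<le> B * (1 + (\<rho> / y) powr s)"
    unfolding B_def using pos s \<rho>(1) \<sigma>(1,3)[OF \<rho>(1)]
    by (intro mult_right_mono add_left_mono powr_mono2 divide_right_mono) auto
  also have "\<dots> = B + \<rho> powr s"
    using pos \<rho>(1) B unfolding By by (simp add: powr_divide field_simps)
  finally show False by simp
qed

text \<open>The flow through the extra edge is one share in the star and a product of two shares in
  the triangle. Their reciprocals are the two sides of the identity in
  \<open>flow_identity_absurd\<close>, and \<open>q \<noteq> 2\<close> becomes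
  \<open>s \<noteq> 1\<close>.\<close>

lemma energies_differ:
  fixes q x y z :: real
  assumes q: "q > 1" "q \<noteq> 2" and pos: "x > 0" "y > 0" "z > 0"
    and eq: "\<And>\<rho>. \<rho> > 0 \<Longrightarrow> star_energy q \<rho> (star_flow q \<rho>) =
      triangle_energy q x y z \<rho> (triangle_flow q x y z \<rho>) (triangle_flow q x y z \<rho> * share q \<rho> y)"
  shows False
proof (rule flow_identity_absurd[where s = "1 / (q - 1)" and \<sigma> = "parallel q y"])
  fix \<rho> :: real assume \<rho>: "\<rho> > 0"
  have "1 + (1 + \<rho>) powr (1 / (q - 1)) = 1 / star_flow q \<rho>"
    using inverse_share[of q "1 + \<rho>" 1] q \<rho> by (simp add: star_flow_def)
  also have "\<dots> = 1 / triangle_flow q x y z \<rho> * (1 / share q \<rho> y)"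
    using flows_agree[OF q(1) pos \<rho> eq] by simp
  also have "\<dots> = (1 + ((z + parallel q y \<rho>) / x) powr (1 / (q - 1))) * (1 + (\<rho> / y) powr (1 / (q - 1)))"
    using q pos \<rho> parallel_pos[of y \<rho> q] by (simp add: triangle_flow_def inverse_share)
  finally show "1 + (1 + \<rho>) powr (1 / (q - 1)) =
     (1 + ((z + parallel q y \<rho>) / x) powr (1 / (q - 1))) * (1 + (\<rho> / y) powr (1 / (q - 1)))" .
qed (use assms parallel_pos parallel_less parallel_tendsto in auto)

section \<open>Distances as minimal energies\<close>

definition flow_energy :: "real \<Rightarrow> ('v, 'e) wgraph \<Rightarrow> ('e \<Rightarrow> real) \<Rightarrow> real" where
  "flow_energy q G f = (\<Sum>e\<in>edges G. weight G e powr (- q) * \<bar>f e\<bar> powr q)"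

text \<open>Taking \<open>q\<close>-th roots is monotone, so a minimiser of the energy also attains
  the infimum that defines the distance.\<close>

lemma flow_dist_attained:
  assumes G: "weighted_multigraph G" and q: "q > 0" and f0: "unit_flow G s t f0"
    and min: "\<And>f. unit_flow G s t f \<Longrightarrow> flow_energy q G f0 \<le> flow_energy q G f"
  shows "flow_dist (ereal q) G s t = ereal (flow_energy q G f0 powr (1 / q))"
proof -
  have "flow_cost (ereal q) G f = flow_energy q G f powr (1 / q)" for f
  proof -
    have "(\<Sum>e\<in>edges G. \<bar>f e / weight G e\<bar> powr q) = flow_energy q G f"
      unfolding flow_energy_def
    proof (rule sum.cong)
      fix e assume "e \<in> edges G"
      then have "weight G e > 0" using G by (simp add: weighted_multigraph_def)
      then show "\<bar>f e / weight G e\<bar> powr q = weight G e powr (- q) * \<bar>f e\<bar> powr q"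
        by (simp add: abs_divide powr_divide powr_minus field_simps)
    qed simp
    then show ?thesis by (simp add: flow_cost_def)
  qed
  moreover have "flow_energy q G f0 \<ge> 0"
    by (simp add: flow_energy_def sum_nonneg)
  ultimately show ?thesis
    unfolding flow_dist_def using f0 min q
    by (intro antisym INF_greatest INF_lower2[of f0]) (auto intro!: powr_mono2)
qed

text \<open>In this form the net outflow unfolds to one summand per edge once the edge set is listed
  explicitly.\<close>

lemma net_outflow_eq:
  assumes "finite (edges G)"
  shows "net_outflow G f v =
    (\<Sum>e\<in>edges G. (if Min (ends G e) = v then f e else 0) - (if Max (ends G e) = v then f e else 0))"
  using assms by (simp add: net_outflow_def sum_subtractf sum.inter_filter)

lemma Min_Max_doubleton:
  fixes u v :: "'a::linorder"
  assumes "u < v"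
  shows "Min {u, v} = u" "Max {u, v} = v"
  using assms by auto

section \<open>The test graphs and their distances\<close>

text \<open>The adjustable edge \<open>{b, c}\<close> misses \<open>r\<close>, so varying
  \<open>W\<close> leaves the labelled star at \<open>r\<close> untouched.\<close>

definition star_graph :: "'v \<Rightarrow> 'v \<Rightarrow> 'v \<Rightarrow> 'v \<Rightarrow> real \<Rightarrow> ('v, 'v set) wgraph" where
  "star_graph a b c r W =
     \<lparr>verts = {a, b, c, r}, edges = {{a, r}, {b, r}, {c, r}, {b, c}}, ends = id,
      weight = (\<lambda>e. if e = {b, c} then W else 1)\<rparr>"

lemma weighted_graph_star_graph:
  assumes "distinct [a, b, c, r]" "W > 0"
  shows "weighted_graph (star_graph a b c r W)"
  using assms by (auto simp: weighted_graph_def weighted_multigraph_def star_graph_def)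

lemma star_star_graph:
  assumes "distinct [a, b, c, r]"
  shows "star (star_graph a b c r W) r = {{a, r}, {b, r}, {c, r}}"
  using assms by (auto simp: star_def star_graph_def)

lemma degree_star_graph:
  assumes "distinct [a, b, c, r]"
  shows "degree (star_graph a b c r W) r = 3"
  using assms by (simp add: degree_def star_star_graph doubleton_eq_iff)

lemma neighbours_star_graph:
  assumes "distinct [a, b, c, r]"
  shows "neighbours (star_graph a b c r W) r = {a, b, c}"
  using assms by (auto simp: neighbours_def star_star_graph) (auto simp: star_graph_def)

lemma clique_three:
  assumes "distinct [a, b, c]"
  shows "clique {a, b, c} = {{a, b}, {b, c}, {a, c}}"
  using assms by (auto simp: clique_def card_2_iff)

lemma flow_dist_star_graph:
  fixes a b c r :: "'v::linorder"
  assumes ord: "a < b" "b < c" "c < r" and q: "q > 1" and W: "W > 0"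
  defines "\<rho> \<equiv> W powr (- q)"
  shows "flow_dist (ereal q) (star_graph a b c r W) a b =
    ereal (star_energy q \<rho> (star_flow q \<rho>) powr (1 / q))"
proof -
  define G where "G = star_graph a b c r W"
  have d: "distinct [a, b, c, r]" using ord by auto
  have neq: "a \<noteq> b" "a \<noteq> c" "a \<noteq> r" "b \<noteq> c" "b \<noteq> r" "c \<noteq> r"
    "b \<noteq> a" "c \<noteq> a" "r \<noteq> a" "c \<noteq> b" "r \<noteq> b" "r \<noteq> c" using ord by auto
  have le: "a < r" "a < c" "b < r" using ord by auto
  have mg: "weighted_multigraph G"
    using weighted_graph_star_graph[OF d W] by (simp add: G_def weighted_graph_def)
  have out: "net_outflow G f v =
      (if a = v then f {a, r} else 0) + (if b = v then f {b, r} + f {b, c} else 0)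
      + (if c = v then f {c, r} - f {b, c} else 0)
      - (if r = v then f {a, r} + f {b, r} + f {c, r} else 0)" for f v
    by (simp add: net_outflow_eq G_def star_graph_def doubleton_eq_iff neq Min_Max_doubleton ord le)
  \<comment> \<open>Conservation leaves one free parameter. Edges point upwards in
    \<open>a < b < c < r\<close>, so the flow from \<open>c\<close> to \<open>b\<close> is
    \<open>- f {b, c}\<close>, the argument \<open>g\<close> of \<open>star_energy\<close>.\<close>
  have unit: "unit_flow G a b f \<longleftrightarrow>
      f {a, r} = 1 \<and> f {b, r} = - (1 - - f {b, c}) \<and> f {c, r} = f {b, c}" for f
    unfolding unit_flow_def out by (auto simp: G_def star_graph_def neq)
  have energy: "flow_energy q G f = star_energy q \<rho> (- f {b, c})" if "unit_flow G a b f" for f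
  proof -
    have "f {a, r} = 1" "f {c, r} = f {b, c}" "\<bar>f {b, r}\<bar> = \<bar>1 + f {b, c}\<bar>"
      using that unfolding unit by linarith+
    then show ?thesis
      using q unfolding flow_energy_def
      by (simp add: G_def star_graph_def doubleton_eq_iff neq star_energy_def \<rho>_def algebra_simps)
  qed
  define g where "g = star_flow q \<rho>"
  define f0 where "f0 e = (if e = {a, r} then 1 else if e = {b, r} then - (1 - g) else - g)" for e
  have f0: "unit_flow G a b f0" "- f0 {b, c} = g"
    unfolding unit by (simp_all add: f0_def doubleton_eq_iff neq)
  have "\<rho> > 0" using W by (simp add: \<rho>_def)
  then show ?thesis
    using flow_dist_attained[OF mg _ f0(1), of q] energy f0 q star_energy_min[OF q, of \<rho>]
    by (simp add: g_def flip: G_def)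
qed

lemma flow_dist_triangle:
  fixes a b c :: "'v::linorder" and G :: "('v, 'v set + 'v set) wgraph"
  assumes ord: "a < b" "b < c" and q: "q > 1" and mg: "weighted_multigraph G"
    and G: "verts G = {a, b, c}" "edges G = {Inl {b, c}, Inr {a, b}, Inr {b, c}, Inr {a, c}}"
      "ends G (Inl {b, c}) = {b, c}"
      "\<And>X. X \<in> {{a, b}, {b, c}, {a, c}} \<Longrightarrow> ends G (Inr X) = X"
  defines "x \<equiv> weight G (Inr {a, b}) powr (- q)" and "y \<equiv> weight G (Inr {b, c}) powr (- q)"
    and "z \<equiv> weight G (Inr {a, c}) powr (- q)" and "\<rho> \<equiv> weight G (Inl {b, c}) powr (- q)"
  shows "flow_dist (ereal q) G a b =
    ereal (triangle_energy q x y z \<rho> (triangle_flow q x y z \<rho>) (triangle_flow q x y z \<rho> * share q \<rho> y)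
      powr (1 / q))"
proof -
  have neq: "a \<noteq> b" "a \<noteq> c" "b \<noteq> c" "b \<noteq> a" "c \<noteq> a" "c \<noteq> b" using ord by auto
  have le: "a < c" using ord by auto
  have pos: "x > 0" "y > 0" "z > 0" "\<rho> > 0"
    using mg G(2) unfolding x_def y_def z_def \<rho>_def weighted_multigraph_def by auto
  have out: "net_outflow G f v =
      (if a = v then f (Inr {a, b}) + f (Inr {a, c}) else 0)
      + (if b = v then f (Inl {b, c}) + f (Inr {b, c}) - f (Inr {a, b}) else 0)
      - (if c = v then f (Inr {a, c}) + f (Inr {b, c}) + f (Inl {b, c}) else 0)" for f v
    by (simp add: net_outflow_eq G doubleton_eq_iff neq Min_Max_doubleton ord le)
  \<comment> \<open>Two free parameters remain: \<open>h\<close> on \<open>Inr {a, c}\<close>, and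
    \<open>k = - f (Inl {b, c})\<close>, the flow from \<open>c\<close> to \<open>b\<close> on the
    surviving edge.\<close>
  have unit: "unit_flow G a b f \<longleftrightarrow>
      f (Inr {a, b}) = 1 - f (Inr {a, c}) \<and>
      f (Inr {b, c}) = - (f (Inr {a, c}) - - f (Inl {b, c}))" for f
    unfolding unit_flow_def out by (auto simp: G neq)
  have energy: "flow_energy q G f = triangle_energy q x y z \<rho> (f (Inr {a, c})) (- f (Inl {b, c}))"
    if "unit_flow G a b f" for f
  proof -
    have "f (Inr {a, b}) = 1 - f (Inr {a, c})"
      "\<bar>f (Inr {b, c})\<bar> = \<bar>f (Inr {a, c}) + f (Inl {b, c})\<bar>"
      using that unfolding unit by linarith+
    then show ?thesis
      unfolding flow_energy_def
      by (simp add: G doubleton_eq_iff neq triangle_energy_def x_def y_def z_def \<rho>_def)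
  qed
  define h k where "h = triangle_flow q x y z \<rho>" and "k = h * share q \<rho> y"
  define f0 where "f0 e = (if e = Inr {a, b} then 1 - h else if e = Inr {b, c} then - (h - k)
    else if e = Inr {a, c} then h else - k)" for e :: "'v set + 'v set"
  have f0: "unit_flow G a b f0" "f0 (Inr {a, c}) = h" "- f0 (Inl {b, c}) = k"
    unfolding unit by (simp_all add: f0_def doubleton_eq_iff neq)
  show ?thesis
    using flow_dist_attained[OF mg _ f0(1), of q] energy f0 q triangle_energy_min[OF q pos]
    by (simp add: h_def k_def)
qed

section \<open>Applying a local transform to the test graphs\<close>

text \<open>Choosing the labels in increasing order fixes all edge orientations at once.\<close>

lemma ex_increasing_quadruple:
  "\<exists>a b c r :: 'v::{infinite, linorder}. a < b \<and> b < c \<and> c < r"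
proof -
  obtain S :: "'v set" where S: "finite S" "card S = 4"
    using infinite_arbitrarily_large[OF infinite_UNIV] by blast
  define xs where "xs = sorted_list_of_set S"
  have "length xs = 4" "sorted_wrt (<) xs"
    using S by (simp_all add: xs_def)
  then have "xs ! 0 < xs ! 1 \<and> xs ! 1 < xs ! 2 \<and> xs ! 2 < xs ! 3"
    by (simp add: sorted_wrt_iff_nth_less)
  then show ?thesis by blast
qed

theorem theorem3p22:
  fixes p :: ereal
  assumes "p \<in> {1..\<infinity>} - {1, 2, \<infinity>}"
  shows "\<not> (\<exists>T :: 'v::{infinite, linorder} transform.
             star_mesh_transform 3 T \<and> local_transform 3 T \<and> preserves_flow_dist p 3 T)"
proof
  assume "\<exists>T :: 'v transform. star_mesh_transform 3 T \<and> local_transform 3 T \<and> preserves_flow_dist p 3 T"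
  then obtain T :: "'v transform" where T: "star_mesh_transform 3 T" "local_transform 3 T"
    "preserves_flow_dist p 3 T" by blast
  obtain q where p: "p = ereal q" and q: "q > 1" "q \<noteq> 2"
    using assms by (cases p) (auto simp: order_le_less)
  obtain a b c r :: 'v where ord: "a < b" "b < c" "c < r"
    using ex_increasing_quadruple by blast
  then have d: "distinct [a, b, c, r]" "distinct [a, b, c]" by auto
  define G where "G = star_graph a b c r"
  define T' where "T' W = T (G W) r" for W
  have G: "weighted_graph (G W)" "r \<in> verts (G W)" "degree (G W) r = 3" if "W > 0" for W
    using weighted_graph_star_graph[OF d(1) that] degree_star_graph[OF d(1)]
    by (simp_all add: G_def) (simp add: star_graph_def)
  have nb: "clique (neighbours (G W) r) = {{a, b}, {b, c}, {a, c}}" for W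
    using d by (simp add: G_def neighbours_star_graph clique_three)
  have "edges (G W) - star (G W) r = {{b, c}}" for W
  proof -
    have "{b, c} \<notin> {{a, r}, {b, r}, {c, r}}"
      using d by (simp add: doubleton_eq_iff)
    moreover have "edges (G W) = insert {b, c} {{a, r}, {b, r}, {c, r}}"
      by (auto simp: G_def star_graph_def)
    ultimately show ?thesis
      unfolding G_def star_star_graph[OF d(1)] by (simp add: insert_Diff_if)
  qed
  moreover have "ends (G W) {b, c} = {b, c}" "weight (G W) {b, c} = W" "verts (G W) - {r} = {a, b, c}" for W
    using d by (auto simp: G_def star_graph_def)
  ultimately have T': "weighted_multigraph (T' W)" "verts (T' W) = {a, b, c}"
      "edges (T' W) = {Inl {b, c}, Inr {a, b}, Inr {b, c}, Inr {a, c}}"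
      "ends (T' W) (Inl {b, c}) = {b, c}" "weight (T' W) (Inl {b, c}) = W"
      "\<And>X. X \<in> {{a, b}, {b, c}, {a, c}} \<Longrightarrow> ends (T' W) (Inr X) = X" if "W > 0" for W
    using T(1)[unfolded star_mesh_transform_def, rule_format, OF conjI[OF G(1) conjI[OF G(2,3)]], OF that that that]
    unfolding nb T'_def by simp_all auto
  \<comment> \<open>Locality enters here: the star at \<open>r\<close> is the same for all
    \<open>W\<close>, so the clique weights are those for \<open>W = 1\<close>.\<close>
  have local: "weight (T' W) (Inr X) = weight (T' 1) (Inr X)"
    if "W > 0" "X \<in> {{a, b}, {b, c}, {a, c}}" for W X
  proof -
    have "star (G W) r = star (G 1) r \<and> (\<forall>e \<in> star (G W) r. weight (G W) e = weight (G 1) e)"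
      using d unfolding G_def star_star_graph[OF d(1)] by (simp add: star_graph_def doubleton_eq_iff) metis
    then show ?thesis
      using T(2)[unfolded local_transform_def, rule_format, of "G W" r "G 1" X] G[OF that(1)] G[of 1] that(2)
      unfolding T'_def nb by simp
  qed
  define x y z where "x = weight (T' 1) (Inr {a, b}) powr (- q)"
    and "y = weight (T' 1) (Inr {b, c}) powr (- q)" and "z = weight (T' 1) (Inr {a, c}) powr (- q)"
  have pos: "x > 0" "y > 0" "z > 0"
    using T'(1,3)[of 1] unfolding x_def y_def z_def weighted_multigraph_def by auto
  show False
  proof (rule energies_differ[OF q pos])
    fix \<rho> :: real assume \<rho>: "\<rho> > 0"
    \<comment> \<open>The weight that gives the extra edge the resistance
      \<open>\<rho>\<close>.\<close>
    define W where "W = \<rho> powr (- 1 / q)"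
    have W: "W > 0" "W powr (- q) = \<rho>"
      using \<rho> q by (simp_all add: W_def powr_powr)
    define h k where "h = triangle_flow q x y z \<rho>" and "k = h * share q \<rho> y"
    have "flow_dist (ereal q) (T' W) a b = flow_dist (ereal q) (G W) a b"
      using T(3)[unfolded preserves_flow_dist_def p, rule_format, OF conjI[OF G(1) conjI[OF G(2,3)]], OF W(1) W(1) W(1), of a b] ord
      by (simp add: T'_def) (auto simp: G_def star_graph_def)
    then have "triangle_energy q x y z \<rho> h k powr (1 / q) = star_energy q \<rho> (star_flow q \<rho>) powr (1 / q)"
      using flow_dist_star_graph[OF ord q(1) W(1)] flow_dist_triangle[OF ord(1,2) q(1) T'(1-4,6)[OF W(1)]]
      by (simp add: local[OF W(1)] T'(5)[OF W(1)] W(2) G_def h_def k_def flip: x_def y_def z_def)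
    \<comment> \<open>The energies are nonnegative, so raising to the power \<open>q\<close>
      recovers them from the distances.\<close>
    then have "(triangle_energy q x y z \<rho> h k powr (1 / q)) powr q
        = (star_energy q \<rho> (star_flow q \<rho>) powr (1 / q)) powr q"
      by simp
    moreover have "triangle_energy q x y z \<rho> h k \<ge> 0" "star_energy q \<rho> (star_flow q \<rho>) \<ge> 0"
      using pos \<rho> by (simp_all add: triangle_energy_def star_energy_def)
    ultimately show "star_energy q \<rho> (star_flow q \<rho>) = triangle_energy q x y z \<rho>
        (triangle_flow q x y z \<rho>) (triangle_flow q x y z \<rho> * share q \<rho> y)"
      using q by (simp add: powr_powr h_def k_def)
  qed
qed

end
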